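(* For any integer partition $\lambda=(\lambda_1,\ldots,\lambda_k)$, the sequence $(\#[\lambda,\lambda+n])_{n\ge0}$ is log-concave, where $[\lambda,\lambda+n]$ denotes the closed interval in Young's lattice. That is, with $a_n=\#[\lambda,\lambda+n]$, one has $a_n^2\ge a_{n-1}a_{n+1}$ for all $n\ge1$.
   Context: An integer partition is a weakly decreasing sequence $\lambda=(\lambda_1,\lambda_2,\ldots,\lambda_k)$ of nonnegative integers (zero parts are allowed). Its Young diagram consists of left-justified rows of boxes with $\lambda_i$ boxes in row $i$; no distinction is made between a partition and its Young diagram. Young's lattice is the set of all partitions ordered by $\lambda\preceq\mu$ iff the Young diagram of $\lambda$ is contained in that of $\mu$. For $\lambda=(\lambda_1,\ldots,\lambda_k)$ and an integer $n\ge0$, $\lambda+n=(\lambda_1+n,\lambda_2+n,\ldots,\lambda_k+n)$. The closed interval is $[\lambda,\mu]=\{\nu\mid\lambda\preceq\nu\preceq\mu\}$, and $\#$ denotes cardinality. *)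

theory Defs
  imports Main
begin

text \<open>A partition is a finite weakly decreasing sequence; zero parts are allowed.\<close>

definition is_partition :: "nat list \<Rightarrow> bool" where
  "is_partition p \<longleftrightarrow> sorted_wrt (\<ge>) p"

text \<open>Boxes are addressed by (row, column), both counted from 0.\<close>

definition young_diagram :: "nat list \<Rightarrow> (nat \<times> nat) set" where
  "young_diagram p = {(i, j). i < length p \<and> j < p ! i}"

text \<open>
  Partitions are identified with their diagrams, so that sequences differing only in
  trailing zeros are the same element of Young's lattice. The order is inclusion.
\<close>

definition young_lattice :: "(nat \<times> nat) set set" where
  "young_lattice = young_diagram ` {p. is_partition p}"

definition young_interval :: "nat list \<Rightarrow> nat list \<Rightarrow> (nat \<times> nat) set set" where
  "young_interval p q = {D \<in> young_lattice. young_diagram p \<subseteq> D \<and> D \<subseteq> young_diagram q}"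

text \<open>
  Here the sequence itself matters, not just its diagram: each of the \<open>length p\<close> parts,
  zero parts included, is increased.
\<close>

definition add_parts :: "nat list \<Rightarrow> nat \<Rightarrow> nat list" where
  "add_parts p n = map (\<lambda>x. x + n) p"

lemma finite_young_diagram: "finite (young_diagram p)"
proof -
  have "young_diagram p = Sigma {..<length p} (\<lambda>i. {..<p ! i})"
    by (auto simp: young_diagram_def)
  then show ?thesis
    by simp
qed

text \<open>Hence \<^const>\<open>card\<close> is the true cardinality of an interval.\<close>

lemma finite_young_interval: "finite (young_interval p q)"
  by (rule finite_subset[of _ "Pow (young_diagram q)"])
    (auto simp: young_interval_def finite_young_diagram)

end

theory Submission
  imports Defs
begin

text \<open>
  The log-concavity is an instance of Daykin's inequality
  \<open>|A| |B| \<le> |A \<or> B| |A \<and> B|\<close> for finite subsets \<open>A\<close>, \<open>B\<close> of a distributive lattice.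
  Adding a full first column to the diagrams identifies \<open>[\<lambda>, \<lambda> + (n - 1)]\<close> with
  \<open>[\<lambda> + 1, \<lambda> + n]\<close>. A join of an element of \<open>[\<lambda> + 1, \<lambda> + n]\<close> with an element of
  \<open>[\<lambda>, \<lambda> + (n + 1)]\<close> lies in \<open>[\<lambda> + 1, \<lambda> + (n + 1)]\<close>, and a meet lies in
  \<open>[\<lambda>, \<lambda> + n]\<close>; undoing the column shift, each of these two intervals has \<open>a n\<close> elements,
  so the inequality reads \<open>a (n - 1) * a (n + 1) \<le> a n * a n\<close>.

  Joins and meets in Young's lattice are unions and intersections of diagrams, because
  diagrams of partitions are exactly the finite down-closed subsets of \<open>\<nat> \<times> \<nat>\<close>
  (\<open>young_lattice_eq\<close>). Hence Daykin's inequality is only required for families of sets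
  (\<open>daykin_sets\<close>), where it is the case of indicator functions in the four functions theorem
  of Ahlswede and Daykin (\<open>four_functions\<close>).
\<close>

section \<open>The four functions theorem for families of sets\<close>

text \<open>
  The four functions theorem on the subsets of a single point; index 0 stands for the empty set.
  With \<open>x = a0 * b1\<close>, \<open>y = a1 * b0\<close>, \<open>P = c1 * d0\<close>, \<open>Q = c0 * d1\<close>, only
  \<open>x + y \<le> P + Q\<close> is at stake. Multiplying the two diagonal hypotheses gives
  \<open>x * y \<le> P * Q\<close>, and \<open>(P - x) * (P - y) \<ge> 0\<close> then yields
  \<open>P * (x + y) \<le> P * (P + Q)\<close>.
\<close>

lemma four_functions_point:
  fixes a0 a1 b0 b1 c0 c1 d0 d1 :: "'a::linordered_idom"
  assumes nonneg: "0 \<le> a0" "0 \<le> a1" "0 \<le> b0" "0 \<le> b1" "0 \<le> c0" "0 \<le> c1" "0 \<le> d0" "0 \<le> d1"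
    and h00: "a0 * b0 \<le> c0 * d0" and h01: "a0 * b1 \<le> c1 * d0"
    and h10: "a1 * b0 \<le> c1 * d0" and h11: "a1 * b1 \<le> c1 * d1"
  shows "(a0 + a1) * (b0 + b1) \<le> (c0 + c1) * (d0 + d1)"
proof -
  define x y P Q where defs: "x = a0 * b1" "y = a1 * b0" "P = c1 * d0" "Q = c0 * d1"
  have "x + y \<le> P + Q"
  proof (cases "P = 0")
    case True
    then have "x + y \<le> 0"
      using h01 h10 unfolding defs by (intro add_nonpos_nonpos) auto
    also have "0 \<le> P + Q"
      using nonneg by (simp add: defs)
    finally show ?thesis .
  next
    case False
    then have "P > 0"
      using nonneg by (simp add: defs less_le)
    have "(a0 * b0) * (a1 * b1) \<le> (c0 * d0) * (c1 * d1)"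
      using nonneg by (intro mult_mono[OF h00 h11]) simp_all
    then have "x * y \<le> P * Q"
      by (simp add: defs mult_ac)
    moreover have "0 \<le> (P - x) * (P - y)"
      using h01 h10 by (simp add: defs)
    ultimately have "P * (x + y) \<le> P * (P + Q)"
      by (simp add: algebra_simps)
    then show ?thesis
      using \<open>P > 0\<close> by simp
  qed
  then show ?thesis
    using h00 h11 by (simp add: defs algebra_simps)
qed

lemma sum_Pow_insert:
  fixes f :: "'b set \<Rightarrow> 'a::comm_monoid_add"
  assumes "finite X" "x \<notin> X"
  shows "sum f (Pow (insert x X)) = (\<Sum>A\<in>Pow X. f A + f (insert x A))"
proof -
  have inj: "inj_on (insert x) (Pow X)"
    using assms(2) by (auto simp: inj_on_def)
  have "sum f (Pow (insert x X)) = sum f (Pow X) + sum f (insert x ` Pow X)"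
    unfolding Pow_insert using assms by (intro sum.union_disjoint) auto
  then show ?thesis
    by (simp add: sum.reindex[OF inj] sum.distrib)
qed

text \<open>
  Summing out one element \<open>x\<close> of the ground set preserves the hypothesis, because for fixed
  \<open>A\<close> and \<open>B\<close> without \<open>x\<close> it is the one-point case; the theorem follows by induction on
  the ground set.
\<close>

theorem four_functions:
  fixes \<alpha> \<beta> \<gamma> \<delta> :: "'b set \<Rightarrow> 'a::linordered_idom"
  assumes "finite X"
    and "\<And>A. A \<subseteq> X \<Longrightarrow> 0 \<le> \<alpha> A \<and> 0 \<le> \<beta> A \<and> 0 \<le> \<gamma> A \<and> 0 \<le> \<delta> A"
    and "\<And>A B. A \<subseteq> X \<Longrightarrow> B \<subseteq> X \<Longrightarrow> \<alpha> A * \<beta> B \<le> \<gamma> (A \<union> B) * \<delta> (A \<inter> B)"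
  shows "sum \<alpha> (Pow X) * sum \<beta> (Pow X) \<le> sum \<gamma> (Pow X) * sum \<delta> (Pow X)"
  using assms
proof (induction X arbitrary: \<alpha> \<beta> \<gamma> \<delta> rule: finite_induct)
  case empty
  then show ?case
    using empty.prems(2)[of "{}" "{}"] by simp
next
  case (insert x X)
  let ?e = "\<lambda>(f :: 'b set \<Rightarrow> 'a) A. f A + f (insert x A)"
  have nonneg: "0 \<le> \<alpha> A \<and> 0 \<le> \<beta> A \<and> 0 \<le> \<gamma> A \<and> 0 \<le> \<delta> A"
    "0 \<le> \<alpha> (insert x A) \<and> 0 \<le> \<beta> (insert x A) \<and> 0 \<le> \<gamma> (insert x A) \<and> 0 \<le> \<delta> (insert x A)"
    if "A \<subseteq> X" for A
    using insert.prems(1)[of A] insert.prems(1)[of "insert x A"] that by auto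
  have "sum (?e \<alpha>) (Pow X) * sum (?e \<beta>) (Pow X) \<le> sum (?e \<gamma>) (Pow X) * sum (?e \<delta>) (Pow X)"
  proof (rule insert.IH)
    fix A assume "A \<subseteq> X"
    then show "0 \<le> ?e \<alpha> A \<and> 0 \<le> ?e \<beta> A \<and> 0 \<le> ?e \<gamma> A \<and> 0 \<le> ?e \<delta> A"
      using nonneg[of A] by simp
  next
    fix A B assume AB: "A \<subseteq> X" "B \<subseteq> X"
    then have x: "x \<notin> A" "x \<notin> B"
      using insert.hyps by auto
    have sub: "A \<subseteq> insert x X" "B \<subseteq> insert x X" "insert x A \<subseteq> insert x X"
      "insert x B \<subseteq> insert x X" "A \<union> B \<subseteq> X" "A \<inter> B \<subseteq> X"
      using AB by auto
    have "\<alpha> A * \<beta> B \<le> \<gamma> (A \<union> B) * \<delta> (A \<inter> B)"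
      using insert.prems(2)[OF sub(1,2)] .
    moreover have "\<alpha> A * \<beta> (insert x B) \<le> \<gamma> (insert x (A \<union> B)) * \<delta> (A \<inter> B)"
      using insert.prems(2)[OF sub(1,4)] x by simp
    moreover have "\<alpha> (insert x A) * \<beta> B \<le> \<gamma> (insert x (A \<union> B)) * \<delta> (A \<inter> B)"
      using insert.prems(2)[OF sub(3,2)] x by simp
    moreover have "\<alpha> (insert x A) * \<beta> (insert x B)
        \<le> \<gamma> (insert x (A \<union> B)) * \<delta> (insert x (A \<inter> B))"
      using insert.prems(2)[OF sub(3,4)] by simp
    ultimately show "?e \<alpha> A * ?e \<beta> B \<le> ?e \<gamma> (A \<union> B) * ?e \<delta> (A \<inter> B)"
      using nonneg AB sub by (intro four_functions_point) auto
  qed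
  then show ?case
    by (simp add: sum_Pow_insert insert.hyps)
qed

corollary daykin_sets:
  assumes X: "finite X" "\<A> \<subseteq> Pow X" "\<B> \<subseteq> Pow X" "\<C> \<subseteq> Pow X" "\<D> \<subseteq> Pow X"
    and union: "\<And>A B. A \<in> \<A> \<Longrightarrow> B \<in> \<B> \<Longrightarrow> A \<union> B \<in> \<C>"
    and inter: "\<And>A B. A \<in> \<A> \<Longrightarrow> B \<in> \<B> \<Longrightarrow> A \<inter> B \<in> \<D>"
  shows "card \<A> * card \<B> \<le> card \<C> * card \<D>"
proof -
  let ?ind = "\<lambda>\<F> S. of_bool (S \<in> \<F>) :: int"
  have card: "sum (?ind \<F>) (Pow X) = int (card \<F>)" if "\<F> \<subseteq> Pow X" for \<F>
    using that X(1) by (simp add: Int_absorb1)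
  have "sum (?ind \<A>) (Pow X) * sum (?ind \<B>) (Pow X)
      \<le> sum (?ind \<C>) (Pow X) * sum (?ind \<D>) (Pow X)"
    using X(1) by (rule four_functions) (auto simp: union inter)
  then have "int (card \<A> * card \<B>) \<le> int (card \<C> * card \<D>)"
    using X by (simp only: card of_nat_mult)
  then show ?thesis
    by (simp only: of_nat_le_iff)
qed

section \<open>Young's lattice as a lattice of down-closed sets\<close>

definition down_closed :: "(nat \<times> nat) set \<Rightarrow> bool" where
  "down_closed D \<longleftrightarrow> (\<forall>i j i' j'. (i, j) \<in> D \<longrightarrow> i' \<le> i \<longrightarrow> j' \<le> j \<longrightarrow> (i', j') \<in> D)"

lemma down_closedD: "down_closed D \<Longrightarrow> (i, j) \<in> D \<Longrightarrow> i' \<le> i \<Longrightarrow> j' \<le> j \<Longrightarrow> (i', j') \<in> D"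
  unfolding down_closed_def by blast

lemma down_closed_young_diagram:
  assumes "is_partition p"
  shows "down_closed (young_diagram p)"
  unfolding down_closed_def
proof (intro allI impI)
  fix i j i' j' assume ij: "(i, j) \<in> young_diagram p" "i' \<le> i" "j' \<le> j"
  then have i: "i < length p" "j < p ! i"
    by (auto simp: young_diagram_def)
  have "p ! i \<le> p ! i'"
    using assms i(1) ij(2) by (cases "i' = i") (auto simp: is_partition_def sorted_wrt_iff_nth_less)
  then show "(i', j') \<in> young_diagram p"
    using i ij by (simp add: young_diagram_def)
qed

lemma down_closed_row:
  assumes "finite D" "down_closed D"
  shows "(i, j) \<in> D \<longleftrightarrow> j < card {j. (i, j) \<in> D}"
proof -
  let ?R = "{j. (i, j) \<in> D}"
  have "finite ?R"
    using finite_vimageI[OF assms(1), of "Pair i"] by (simp add: vimage_def inj_on_def)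
  have "{..j} \<subseteq> ?R" if "j \<in> ?R" for j
    using that assms(2) by (auto dest: down_closedD)
  then have less: "j < card ?R" if "j \<in> ?R" for j
    using card_mono[OF \<open>finite ?R\<close>, of "{..j}"] that by (simp add: Suc_le_eq)
  then have "?R \<subseteq> {..<card ?R}"
    by auto
  then have "?R = {..<card ?R}"
    by (intro card_subset_eq) auto
  then show ?thesis
    by blast
qed

text \<open>
  A finite down-closed set is the diagram of the sequence of its row lengths. Cutting this
  sequence off at any bound on the row indices is harmless, as the diagram
  does not see trailing zeros.
\<close>

lemma young_lattice_eq: "young_lattice = {D. finite D \<and> down_closed D}"
proof (intro equalityI subsetI)
  fix D assume "D \<in> young_lattice"
  then show "D \<in> {D. finite D \<and> down_closed D}"
    by (auto simp: young_lattice_def finite_young_diagram down_closed_young_diagram)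
next
  fix D :: "(nat \<times> nat) set" assume "D \<in> {D. finite D \<and> down_closed D}"
  then have D: "finite D" "down_closed D"
    by auto
  obtain N where N: "\<And>i j. (i, j) \<in> D \<Longrightarrow> i < N"
    using finite_imageI[OF D(1), of fst] unfolding finite_nat_set_iff_bounded by force
  define r where "r i = card {j. (i, j) \<in> D}" for i
  have row: "(i, j) \<in> D \<longleftrightarrow> j < r i" for i j
    unfolding r_def by (rule down_closed_row[OF D])
  have "r i' \<le> r i" if "i \<le> i'" for i i'
  proof (rule ccontr)
    assume "\<not> r i' \<le> r i"
    then have "(i', r i) \<in> D"
      by (simp add: row)
    then have "(i, r i) \<in> D"
      using D(2) that by (auto dest: down_closedD)
    then show False
      by (simp add: row)
  qed
  then have "is_partition (map r [0..<N])"
    by (simp add: is_partition_def sorted_wrt_iff_nth_less)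
  moreover have "young_diagram (map r [0..<N]) = D"
    using N by (auto simp: young_diagram_def row)
  ultimately show "D \<in> young_lattice"
    unfolding young_lattice_def by blast
qed

lemma young_lattice_Un: "D \<in> young_lattice \<Longrightarrow> E \<in> young_lattice \<Longrightarrow> D \<union> E \<in> young_lattice"
  unfolding young_lattice_eq down_closed_def by blast

lemma young_lattice_Int: "D \<in> young_lattice \<Longrightarrow> E \<in> young_lattice \<Longrightarrow> D \<inter> E \<in> young_lattice"
  unfolding young_lattice_eq down_closed_def by blast

section \<open>Shifting an interval by one column\<close>

lemma mem_young_diagram_add_parts:
  "(i, j) \<in> young_diagram (add_parts p n) \<longleftrightarrow> i < length p \<and> j < p ! i + n"
  by (auto simp: young_diagram_def add_parts_def)

lemma young_diagram_add_parts_mono: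
  "m \<le> n \<Longrightarrow> young_diagram (add_parts p m) \<subseteq> young_diagram (add_parts p n)"
  by (auto simp: mem_young_diagram_add_parts)

text \<open>
  The number of rows \<open>k\<close> is a parameter because zero parts are increased too, and a diagram does
  not remember how many of them its partition has.
\<close>

definition add_column :: "nat \<Rightarrow> (nat \<times> nat) set \<Rightarrow> (nat \<times> nat) set" where
  "add_column k D = {(i, j). i < k \<and> (case j of 0 \<Rightarrow> True | Suc j' \<Rightarrow> (i, j') \<in> D)}"

definition drop_column :: "(nat \<times> nat) set \<Rightarrow> (nat \<times> nat) set" where
  "drop_column D = {(i, j). (i, Suc j) \<in> D}"

lemma mem_add_column [simp]:
  "(i, 0) \<in> add_column k D \<longleftrightarrow> i < k"
  "(i, Suc j) \<in> add_column k D \<longleftrightarrow> i < k \<and> (i, j) \<in> D"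
  by (auto simp: add_column_def)

lemma mem_drop_column [simp]: "(i, j) \<in> drop_column D \<longleftrightarrow> (i, Suc j) \<in> D"
  by (simp add: drop_column_def)

text \<open>
  Finiteness of the shifted sets comes for free from the upper end of the interval.
\<close>

lemma mem_young_interval_add_parts:
  "D \<in> young_interval (add_parts p l) (add_parts p m) \<longleftrightarrow>
    down_closed D \<and> (\<forall>i<length p. \<forall>j<p ! i + l. (i, j) \<in> D) \<and>
    (\<forall>i j. (i, j) \<in> D \<longrightarrow> i < length p \<and> j < p ! i + m)"
proof -
  have "finite D" if "D \<subseteq> young_diagram (add_parts p m)"
    using finite_subset[OF that finite_young_diagram] .
  moreover have "D \<subseteq> young_diagram (add_parts p m) \<longleftrightarrow>
      (\<forall>i j. (i, j) \<in> D \<longrightarrow> i < length p \<and> j < p ! i + m)"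
    by (force simp: mem_young_diagram_add_parts[symmetric])
  moreover have "young_diagram (add_parts p l) \<subseteq> D \<longleftrightarrow>
      (\<forall>i<length p. \<forall>j<p ! i + l. (i, j) \<in> D)"
    by (force simp: mem_young_diagram_add_parts subset_iff)
  ultimately show ?thesis
    unfolding young_interval_def young_lattice_eq by blast
qed

lemma down_closed_add_column:
  assumes "down_closed D"
  shows "down_closed (add_column k D)"
  unfolding down_closed_def
proof (intro allI impI)
  fix i j i' j' assume "(i, j) \<in> add_column k D" "i' \<le> i" "j' \<le> j"
  then show "(i', j') \<in> add_column k D"
    using assms by (cases j; cases j') (auto dest: down_closedD)
qed

lemma down_closed_drop_column: "down_closed D \<Longrightarrow> down_closed (drop_column D)"
  unfolding down_closed_def by (metis Suc_le_mono mem_drop_column)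

lemma card_young_interval_Suc:
  "card (young_interval (add_parts p (Suc l)) (add_parts p (Suc m))) =
   card (young_interval (add_parts p l) (add_parts p m))"
proof -
  let ?I = "\<lambda>l m. young_interval (add_parts p l) (add_parts p m)"
  let ?k = "length p"
  have "bij_betw (add_column ?k) (?I l m) (?I (Suc l) (Suc m))"
  proof (rule bij_betw_byWitness[where f' = drop_column])
    show "\<forall>D\<in>?I l m. drop_column (add_column ?k D) = D"
      by (auto simp: mem_young_interval_add_parts)
    \<comment> \<open>The first column of \<open>D\<close> is full, as its lower bound \<open>p + Suc l\<close> has positive parts.\<close>
    show "\<forall>D\<in>?I (Suc l) (Suc m). add_column ?k (drop_column D) = D"
    proof
      fix D assume D: "D \<in> ?I (Suc l) (Suc m)"
      have "(i, j) \<in> add_column ?k (drop_column D) \<longleftrightarrow> (i, j) \<in> D" for i j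
        using D by (cases j) (auto simp: mem_young_interval_add_parts)
      then show "add_column ?k (drop_column D) = D"
        by auto
    qed
    show "add_column ?k ` ?I l m \<subseteq> ?I (Suc l) (Suc m)"
    proof
      fix E assume "E \<in> add_column ?k ` ?I l m"
      then obtain D where D: "D \<in> ?I l m" "E = add_column ?k D"
        by auto
      have "(i, j) \<in> E" if "i < ?k" "j < p ! i + Suc l" for i j
        using D that by (cases j) (auto simp: mem_young_interval_add_parts)
      moreover have "i < ?k \<and> j < p ! i + Suc m" if "(i, j) \<in> E" for i j
        using D that by (cases j) (auto simp: mem_young_interval_add_parts)
      moreover have "down_closed E"
        using D by (simp add: mem_young_interval_add_parts down_closed_add_column)
      ultimately show "E \<in> ?I (Suc l) (Suc m)"
        unfolding mem_young_interval_add_parts by blast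
    qed
    show "drop_column ` ?I (Suc l) (Suc m) \<subseteq> ?I l m"
    proof
      fix E assume "E \<in> drop_column ` ?I (Suc l) (Suc m)"
      then obtain D where D: "D \<in> ?I (Suc l) (Suc m)" "E = drop_column D"
        by auto
      have "(i, j) \<in> E" if "i < ?k" "j < p ! i + l" for i j
        using D that by (auto simp: mem_young_interval_add_parts)
      moreover have "i < ?k \<and> j < p ! i + m" if "(i, j) \<in> E" for i j
        using D that by (fastforce simp: mem_young_interval_add_parts)
      moreover have "down_closed E"
        using D by (simp add: mem_young_interval_add_parts down_closed_drop_column)
      ultimately show "E \<in> ?I l m"
        unfolding mem_young_interval_add_parts by blast
    qed
  qed
  then show ?thesis
    by (rule bij_betw_same_card[symmetric])
qed

section \<open>Log-concavity\<close>

theorem theorem3p1: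
  fixes lam :: "nat list" and a :: "nat \<Rightarrow> nat"
  assumes "is_partition lam"
  defines "a \<equiv> \<lambda>n. card (young_interval lam (add_parts lam n))"
  shows "\<forall>n\<ge>1. (a n)\<^sup>2 \<ge> a (n - 1) * a (n + 1)"
proof (intro allI impI)
  fix n :: nat assume "n \<ge> 1"
  let ?d = "\<lambda>m. young_diagram (add_parts lam m)"
  let ?I = "\<lambda>l m. young_interval (add_parts lam l) (add_parts lam m)"
  have a: "a m = card (?I 0 m)" for m
    by (simp add: a_def add_parts_def)
  have shift: "card (?I 1 (Suc m)) = a m" for m
    using card_young_interval_Suc[of lam 0 m] by (simp add: a)
  have chain: "?d 0 \<subseteq> ?d 1" "?d n \<subseteq> ?d (Suc n)"
    by (simp_all add: young_diagram_add_parts_mono)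
  have "card (?I 1 n) * card (?I 0 (Suc n)) \<le> card (?I 1 (Suc n)) * card (?I 0 n)"
  proof (rule daykin_sets[where X = "?d (Suc n)"])
    fix A B assume "A \<in> ?I 1 n" "B \<in> ?I 0 (Suc n)"
    then have AB: "A \<in> young_lattice" "B \<in> young_lattice"
      "?d 1 \<subseteq> A" "A \<subseteq> ?d n" "?d 0 \<subseteq> B" "B \<subseteq> ?d (Suc n)"
      by (auto simp: young_interval_def)
    show "A \<union> B \<in> ?I 1 (Suc n)"
      using AB chain by (auto simp: young_interval_def young_lattice_Un)
    show "A \<inter> B \<in> ?I 0 n"
      using AB chain by (auto simp: young_interval_def young_lattice_Int)
  qed (use chain finite_young_diagram in \<open>auto simp: young_interval_def\<close>)
  then show "(a n)\<^sup>2 \<ge> a (n - 1) * a (n + 1)"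
    using shift[of "n - 1"] shift[of n] \<open>n \<ge> 1\<close> by (simp add: a power2_eq_square)
qed

end
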